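(* Let $m \geq 3$ and let $\zeta$ be a polarity of the projective space $\mathrm{PG}(m-1,q)$. Let $\pi$ be a subspace of projective dimension $k-1 \geq 0$ which is totally isotropic with respect to $\zeta$ (i.e. $\pi \subseteq \pi^\zeta$). Let $\Gamma$ be the graph with vertex set $V := \mathrm{PG}(m-1,q) \setminus \pi^\zeta$ (the set of points of $\mathrm{PG}(m-1,q)$ not in $\pi^\zeta$), in which two (possibly equal) vertices $x$ and $y$ are adjacent whenever $x \in y^\zeta$. Then $\Gamma$ is a proper LDDG whose canonical partition consists of the classes of the equivalence relation $R$ on $V$ defined by $(x,y) \in R$ if and only if $\langle x,\pi \rangle = \langle y,\pi \rangle$.
   Context: $\mathrm{PG}(m-1,q)$ is the projective space of the $m$-dimensional vector space $\mathbb{F}_q^m$: its points are the 1-dimensional subspaces, and a projective subspace of dimension $i$ is the set of points contained in an $(i+1)$-dimensional vector subspace; $\langle S_1,S_2\rangle$ denotes the smallest subspace containing $S_1$ and $S_2$. A polarity $\zeta$ is a bijection of the set of subspaces that reverses inclusion and satisfies $\zeta^2=\mathrm{id}$; for a point $x$, $x^\zeta$ is a hyperplane, and $x \in y^\zeta$ iff $y \in x^\zeta$. Graphs here are finite, undirected, without multiple edges, but loops are allowed: a vertex may be adjacent to itself (it then has a loop). For a vertex $x$, $\Gamma(x)$ is the set of vertices adjacent to $x$ (containing $x$ iff $x$ has a loop), and the degree of $x$ is $|\Gamma(x)|$ (a loop contributes exactly 1). The common neighbours of vertices $x,y$ are the elements of $\Gamma(x)\cap\Gamma(y)$. A $k$-regular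 graph on $v$ vertices is an LDDG (divisible design graph with possible loops) with parameters $(v,k,\lambda_1,\lambda_2,m,n)$ if its vertex set can be partitioned into $m$ classes of size $n$ such that any two distinct vertices of the same class have exactly $\lambda_1$ common neighbours and any two vertices of different classes have exactly $\lambda_2$ common neighbours. It is proper if $m,n \geq 2$ and $\lambda_1 \neq \lambda_2$; the partition is then uniquely determined and called the canonical partition. *)

theory Defs
  imports "HOL-Analysis.Analysis" "Graph_Theory.Pair_Digraph"
begin

section \<open>Projective spaces over finite fields\<close>

text \<open>
  \<open>PG(m-1,q)\<close> is modelled on the vector space \<open>'a ^ 'n\<close> with \<open>'a\<close> a finite field of order
  \<open>q = CARD('a)\<close> and \<open>m = CARD('n)\<close>. The operations \<open>vec.subspace\<close> and \<open>vec.dim\<close> are those of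
  the vector space over \<open>'a\<close> (not over the reals).
\<close>

definition pg_points :: "('a::field ^ 'n) set set" where
  "pg_points = {p. vec.subspace p \<and> vec.dim p = 1}"

definition pg_subspace_of_dim :: "int \<Rightarrow> ('a::field ^ 'n) set set \<Rightarrow> bool" where
  "pg_subspace_of_dim i S \<longleftrightarrow>
     (\<exists>U. vec.subspace U \<and> int (vec.dim U) = i + 1 \<and> S = {p \<in> pg_points. p \<subseteq> U})"

text \<open>
  Projective subspaces include the empty one (of dimension \<open>-1\<close>) and the whole space; a polarity
  interchanges these two.
\<close>

definition pg_subspaces :: "('a::field ^ 'n) set set set" where
  "pg_subspaces = {S. \<exists>i. pg_subspace_of_dim i S}"

definition pg_join ::
    "('a::field ^ 'n) set set \<Rightarrow> ('a ^ 'n) set set \<Rightarrow> ('a ^ 'n) set set" where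
  "pg_join S T = \<Inter>{W \<in> pg_subspaces. S \<subseteq> W \<and> T \<subseteq> W}"

definition polarity :: "(('a::field ^ 'n) set set \<Rightarrow> ('a ^ 'n) set set) \<Rightarrow> bool" where
  "polarity \<zeta> \<longleftrightarrow>
     bij_betw \<zeta> pg_subspaces pg_subspaces \<and>
     (\<forall>S\<in>pg_subspaces. \<forall>T\<in>pg_subspaces. S \<subseteq> T \<longrightarrow> \<zeta> T \<subseteq> \<zeta> S) \<and>
     (\<forall>S\<in>pg_subspaces. \<zeta> (\<zeta> S) = S)"


section \<open>Divisible design graphs with possible loops\<close>

text \<open>
  Finite undirected graphs without multiple edges, but possibly with loops, are the
  \<open>pair_pseudo_graph\<close>s: finite digraphs whose arcs form a symmetric, not necessarily irreflexive,
  relation on the vertices. A loop at \<open>x\<close> is the single arc \<open>(x, x)\<close>.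
\<close>

definition neighbours :: "'v pair_pre_digraph \<Rightarrow> 'v \<Rightarrow> 'v set" where
  "neighbours G x = {y \<in> pverts G. (x, y) \<in> parcs G}"

definition regular_graph :: "'v pair_pre_digraph \<Rightarrow> nat \<Rightarrow> bool" where
  "regular_graph G k \<longleftrightarrow> (\<forall>x\<in>pverts G. card (neighbours G x) = k)"

definition LDDG_partition ::
    "'v pair_pre_digraph \<Rightarrow> nat \<Rightarrow> nat \<Rightarrow> nat \<Rightarrow> nat \<Rightarrow> 'v set set \<Rightarrow> bool" where
  "LDDG_partition G l1 l2 m n P \<longleftrightarrow>
     partition_on (pverts G) P \<and> card P = m \<and> (\<forall>C\<in>P. card C = n) \<and>
     (\<forall>C\<in>P. \<forall>x\<in>C. \<forall>y\<in>C. x \<noteq> y \<longrightarrow> card (neighbours G x \<inter> neighbours G y) = l1) \<and>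
     (\<forall>C\<in>P. \<forall>D\<in>P. C \<noteq> D \<longrightarrow>
        (\<forall>x\<in>C. \<forall>y\<in>D. card (neighbours G x \<inter> neighbours G y) = l2))"

definition LDDG ::
    "'v pair_pre_digraph \<Rightarrow> nat \<Rightarrow> nat \<Rightarrow> nat \<Rightarrow> nat \<Rightarrow> nat \<Rightarrow> nat \<Rightarrow> bool" where
  "LDDG G v k l1 l2 m n \<longleftrightarrow>
     pair_pseudo_graph G \<and> card (pverts G) = v \<and> regular_graph G k \<and>
     (\<exists>P. LDDG_partition G l1 l2 m n P)"

definition proper_LDDG ::
    "'v pair_pre_digraph \<Rightarrow> nat \<Rightarrow> nat \<Rightarrow> nat \<Rightarrow> nat \<Rightarrow> nat \<Rightarrow> nat \<Rightarrow> bool" where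
  "proper_LDDG G v k l1 l2 m n \<longleftrightarrow>
     LDDG G v k l1 l2 m n \<and> m \<ge> 2 \<and> n \<ge> 2 \<and> l1 \<noteq> l2"

definition canonical_partition :: "'v pair_pre_digraph \<Rightarrow> 'v set set" where
  "canonical_partition G =
     (THE P. \<exists>v k l1 l2 m n. proper_LDDG G v k l1 l2 m n \<and> LDDG_partition G l1 l2 m n P)"

text \<open>
  The description in \<open>canonical_partition\<close> is justified: two partitions witnessing that a graph is
  a proper LDDG coincide, even if they are not assumed to belong to the same parameters.
\<close>

lemma LDDG_partition_same_cell_iff:
  assumes "LDDG_partition G l1 l2 m n P" "l1 \<noteq> l2" "x \<in> pverts G" "y \<in> pverts G" "x \<noteq> y"
  shows "(\<exists>C\<in>P. x \<in> C \<and> y \<in> C) \<longleftrightarrow> card (neighbours G x \<inter> neighbours G y) = l1"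
    and "\<not> (\<exists>C\<in>P. x \<in> C \<and> y \<in> C) \<longleftrightarrow> card (neighbours G x \<inter> neighbours G y) = l2"
proof -
  have part: "partition_on (pverts G) P"
    and same: "\<forall>C\<in>P. \<forall>x\<in>C. \<forall>y\<in>C. x \<noteq> y \<longrightarrow>
      card (neighbours G x \<inter> neighbours G y) = l1"
    and diff: "\<forall>C\<in>P. \<forall>D\<in>P. C \<noteq> D \<longrightarrow>
      (\<forall>x\<in>C. \<forall>y\<in>D. card (neighbours G x \<inter> neighbours G y) = l2)"
    using assms(1) unfolding LDDG_partition_def by simp_all
  obtain C where C: "C \<in> P" "x \<in> C" using part assms(3) unfolding partition_on_def by blast
  obtain D where D: "D \<in> P" "y \<in> D" using part assms(4) unfolding partition_on_def by blast
  have *: "(\<exists>C\<in>P. x \<in> C \<and> y \<in> C) \<and> card (neighbours G x \<inter> neighbours G y) = l1 \<or>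
    \<not> (\<exists>C\<in>P. x \<in> C \<and> y \<in> C) \<and> card (neighbours G x \<inter> neighbours G y) = l2"
  proof (cases "\<exists>C\<in>P. x \<in> C \<and> y \<in> C")
    case True
    then show ?thesis using same assms(5) by metis
  next
    case False
    then have "C \<noteq> D" using C D by blast
    then show ?thesis using diff C D False by simp
  qed
  show "(\<exists>C\<in>P. x \<in> C \<and> y \<in> C) \<longleftrightarrow> card (neighbours G x \<inter> neighbours G y) = l1"
    using * assms(2) by argo
  show "\<not> (\<exists>C\<in>P. x \<in> C \<and> y \<in> C) \<longleftrightarrow> card (neighbours G x \<inter> neighbours G y) = l2"
    using * assms(2) by argo
qed

lemma partition_on_subset_if_same_cell:
  assumes P: "partition_on V P" and Q: "partition_on V Q"
    and same: "\<And>x y. x \<in> V \<Longrightarrow> y \<in> V \<Longrightarrow>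
      (\<exists>C\<in>P. x \<in> C \<and> y \<in> C) \<longleftrightarrow> (\<exists>C\<in>Q. x \<in> C \<and> y \<in> C)"
  shows "P \<subseteq> Q"
proof
  fix C assume C: "C \<in> P"
  then obtain x where x: "x \<in> C" using P unfolding partition_on_def by fastforce
  have CV: "C \<subseteq> V" using C P unfolding partition_on_def by blast
  obtain D where D: "D \<in> Q" "x \<in> D" using x CV Q unfolding partition_on_def by blast
  have DV: "D \<subseteq> V" using D Q unfolding partition_on_def by blast
  have "y \<in> C \<longleftrightarrow> y \<in> D" for y
  proof
    assume y: "y \<in> C"
    then obtain D' where "D' \<in> Q" "x \<in> D'" "y \<in> D'" using same[of x y] x C CV by blast
    moreover have "D' = D"
      using Q D calculation unfolding partition_on_def disjoint_def by blast
    ultimately show "y \<in> D" by simp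
  next
    assume y: "y \<in> D"
    then obtain C' where "C' \<in> P" "x \<in> C'" "y \<in> C'" using same[of x y] x D DV CV by blast
    moreover have "C' = C"
      using P C x calculation unfolding partition_on_def disjoint_def by blast
    ultimately show "y \<in> C" by simp
  qed
  then have "C = D" by (rule set_eqI)
  then show "C \<in> Q" using D by simp
qed

lemma proper_LDDG_partition_unique:
  assumes "proper_LDDG G v k l1 l2 m n" and P: "LDDG_partition G l1 l2 m n P"
    and "proper_LDDG G v' k' l1' l2' m' n'" and Q: "LDDG_partition G l1' l2' m' n' Q"
  shows "P = Q"
proof -
  have ne: "l1 \<noteq> l2" "l1' \<noteq> l2'" and ge: "m \<ge> 2" "n \<ge> 2" "n' \<ge> 2" "m' \<ge> 2"
    using assms(1,3) unfolding proper_LDDG_def by auto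
  have pP: "partition_on (pverts G) P" and pQ: "partition_on (pverts G) Q"
    using P Q unfolding LDDG_partition_def by auto
  note cP = LDDG_partition_same_cell_iff[OF P ne(1)]
  note cQ = LDDG_partition_same_cell_iff[OF Q ne(2)]
  have two: "\<exists>x\<in>A. \<exists>y\<in>A. x \<noteq> y" if "card A \<ge> 2" for A :: "'c set"
    using card_le_Suc0_iff_eq[of A] that card.infinite[of A] by fastforce
  have cell: "A = B" if "partition_on (pverts G) S" "A \<in> S" "B \<in> S" "u \<in> A" "u \<in> B" for S A B u
    using that unfolding partition_on_def disjoint_def by blast
  have eq: "l1 = l1'"
  proof (rule ccontr)
    assume neq: "l1 \<noteq> l1'"
    have "card P \<ge> 2" "card Q \<ge> 2" using P Q ge unfolding LDDG_partition_def by auto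
    then obtain C D E where CDE: "C \<in> P" "D \<in> P" "C \<noteq> D" "E \<in> Q"
      using two[of P] two[of Q] by blast
    have "card C \<ge> 2" "card D \<ge> 2" "card E \<ge> 2"
      using P Q ge CDE unfolding LDDG_partition_def by auto
    then obtain x x' y z z' where
      xyz: "x \<in> C" "x' \<in> C" "x \<noteq> x'" "y \<in> D" "z \<in> E" "z' \<in> E" "z \<noteq> z'"
      using two[of C] two[of D] two[of E] by blast
    have V: "x \<in> pverts G" "x' \<in> pverts G" "y \<in> pverts G" "z \<in> pverts G" "z' \<in> pverts G"
      using xyz CDE pP pQ unfolding partition_on_def by blast+
    have nCD: "x \<notin> D" "x' \<notin> D" "y \<notin> C"
      using CDE xyz pP unfolding partition_on_def disjoint_def by blast+
    have z1: "card (neighbours G z \<inter> neighbours G z') = l1'"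
      using cQ(1) V xyz CDE by blast
    then have l2: "l2 = l1'" using cP[OF V(4,5) xyz(7)] neq by auto
    have dP: "\<not> (\<exists>F\<in>P. u \<in> F \<and> y \<in> F)" if "u \<in> C" for u
      using cell[OF pP _ CDE(1) _ that] nCD(3) by blast
    have "card (neighbours G x \<inter> neighbours G y) = l1'"
         "card (neighbours G x' \<inter> neighbours G y) = l1'"
      using cP(2)[of x y] cP(2)[of x' y] dP V xyz nCD l2 by auto
    then have "\<exists>F\<in>Q. x \<in> F \<and> y \<in> F" "\<exists>F\<in>Q. x' \<in> F \<and> y \<in> F"
      using cQ(1)[of x y] cQ(1)[of x' y] V xyz nCD by auto
    then have "\<exists>F\<in>Q. x \<in> F \<and> x' \<in> F"
      using cell[OF pQ] by blast
    then have "card (neighbours G x \<inter> neighbours G x') = l1'"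
      using cQ(1)[of x x'] V xyz by blast
    moreover have "card (neighbours G x \<inter> neighbours G x') = l1"
      using cP(1)[of x x'] V xyz CDE by blast
    ultimately show False using neq by simp
  qed
  have same: "(\<exists>C\<in>P. x \<in> C \<and> y \<in> C) \<longleftrightarrow> (\<exists>C\<in>Q. x \<in> C \<and> y \<in> C)"
    if "x \<in> pverts G" "y \<in> pverts G" for x y
  proof (cases "x = y")
    case True
    then show ?thesis using that pP pQ unfolding partition_on_def by blast
  next
    case False
    then show ?thesis using cP(1)[OF that] cQ(1)[OF that] eq by simp
  qed
  show ?thesis
  proof (rule equalityI)
    show "P \<subseteq> Q"
      by (rule partition_on_subset_if_same_cell[OF pP pQ]) (rule same)
    show "Q \<subseteq> P"
      by (rule partition_on_subset_if_same_cell[OF pQ pP]) (rule same[symmetric])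
  qed
qed

lemma canonical_partition_eqI:
  assumes "proper_LDDG G v k l1 l2 m n" "LDDG_partition G l1 l2 m n P"
  shows "canonical_partition G = P"
  unfolding canonical_partition_def
proof (rule the_equality)
  show "\<exists>v k l1 l2 m n. proper_LDDG G v k l1 l2 m n \<and> LDDG_partition G l1 l2 m n P"
    using assms by (intro exI conjI)
next
  fix Q assume "\<exists>v k l1 l2 m n. proper_LDDG G v k l1 l2 m n \<and> LDDG_partition G l1 l2 m n Q"
  then obtain v' k' l1' l2' m' n' where
    "proper_LDDG G v' k' l1' l2' m' n'" "LDDG_partition G l1' l2' m' n' Q" by blast
  then show "Q = P" using assms by (rule proper_LDDG_partition_unique)
qed


section \<open>The graph defined by a polarity and a totally isotropic subspace\<close>

definition polarity_graph ::
    "(('a::field ^ 'n) set set \<Rightarrow> ('a ^ 'n) set set) \<Rightarrow> ('a ^ 'n) set set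
       \<Rightarrow> ('a ^ 'n) set pair_pre_digraph" where
  "polarity_graph \<zeta> \<pi> =
     \<lparr> pverts = pg_points - \<zeta> \<pi>,
       parcs = {(x, y). x \<in> pg_points - \<zeta> \<pi> \<and> y \<in> pg_points - \<zeta> \<pi> \<and> x \<in> \<zeta> {y}} \<rparr>"

end

theory Submission
  imports Defs
begin

text \<open>
  A polarity is an inclusion-reversing involution \<open>P\<close> of the lattice of vector subspaces, so it
  exchanges sums and intersections and sends dimension \<open>d\<close> to \<open>m - d\<close>. Let \<open>A\<close> be the vector
  subspace of \<open>\<pi>\<close>, of dimension \<open>k\<close>. The common neighbours of \<open>x\<close> and \<open>y\<close> are the points of
  \<open>P (x + y)\<close> outside \<open>P (x + y + A)\<close>; since the number of points of a subspace depends only on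
  its dimension, their number is determined by \<open>dim (x + y + A)\<close>, which is \<open>k + 1\<close> if
  \<open>x + A = y + A\<close> and \<open>k + 2\<close> otherwise.
\<close>

section \<open>Points of a vector subspace\<close>

definition points_in :: "('a::field ^ 'n) set \<Rightarrow> ('a ^ 'n) set set" where
  "points_in U = {p \<in> pg_points. p \<subseteq> U}"

definition vec_sup :: "('a::field ^ 'n) set \<Rightarrow> ('a ^ 'n) set \<Rightarrow> ('a ^ 'n) set" where
  "vec_sup U W = vec.span (U \<union> W)"

lemma subspace_vec_sup [simp]: "vec.subspace (vec_sup U W)"
  unfolding vec_sup_def by simp

lemma span_subspace: "vec.subspace U \<Longrightarrow> vec.span U = U"
  by (simp only: vec.span_eq_iff)

text \<open>The integer index imposes nothing: \<open>vec.dim U - 1\<close> always serves, with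
  value -1 for the zero subspace.\<close>

lemma pg_subspaces_iff: "S \<in> pg_subspaces \<longleftrightarrow> (\<exists>U. vec.subspace U \<and> S = points_in U)"
proof
  assume "\<exists>U. vec.subspace U \<and> S = points_in U"
  then obtain U where "vec.subspace U" "S = points_in U" by blast
  then have "pg_subspace_of_dim (int (vec.dim U) - 1) S"
    unfolding pg_subspace_of_dim_def points_in_def by auto
  then show "S \<in> pg_subspaces" unfolding pg_subspaces_def by blast
qed (auto simp: pg_subspaces_def pg_subspace_of_dim_def points_in_def)

lemma points_in_mono: "U \<subseteq> W \<Longrightarrow> points_in U \<subseteq> points_in W"
  unfolding points_in_def by auto

lemma points_in_Int: "points_in (U \<inter> W) = points_in U \<inter> points_in W"
  unfolding points_in_def by auto

lemma subspace_point: "p \<in> pg_points \<Longrightarrow> vec.subspace p"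
  and dim_point: "p \<in> pg_points \<Longrightarrow> vec.dim p = 1"
  unfolding pg_points_def by auto

lemma span_singleton_point: "v \<noteq> 0 \<Longrightarrow> vec.span {v} \<in> pg_points"
  unfolding pg_points_def by simp

lemma point_eq_span:
  assumes "p \<in> pg_points"
  obtains v where "v \<noteq> 0" "p = vec.span {v}"
proof -
  obtain B where B: "B \<subseteq> p" "vec.independent B" "vec.span B = p" "card B = vec.dim p"
    using vec.basis_subspace_exists[OF subspace_point[OF assms]] by metis
  then obtain v where v: "B = {v}" using dim_point[OF assms] card_1_singletonE by metis
  moreover have "v \<noteq> 0" using v B(2) vec.dependent_zero[of B] by blast
  ultimately show thesis using that B(3) by blast
qed

lemma span_singleton_subset_iff: "vec.subspace U \<Longrightarrow> vec.span {v} \<subseteq> U \<longleftrightarrow> v \<in> U"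
  using vec.span_base[of v "{v}"] vec.span_minimal[of "{v}" U] by auto

text \<open>Every nonzero vector spans a point, so a subspace is recovered from its points. Together
  with \<open>pg_subspaces_iff\<close>, this makes \<open>points_in\<close> an order isomorphism
  from vector subspaces onto projective ones.\<close>

lemma points_in_subset_iff:
  assumes "vec.subspace U" "vec.subspace W"
  shows "points_in U \<subseteq> points_in W \<longleftrightarrow> U \<subseteq> W"
proof
  assume sub: "points_in U \<subseteq> points_in W"
  show "U \<subseteq> W"
  proof
    fix v assume v: "v \<in> U"
    show "v \<in> W"
    proof (cases "v = 0")
      case True
      then show ?thesis using assms(2) by (simp add: vec.subspace_0)
    next
      case False
      then have "vec.span {v} \<in> points_in U"
        using v assms(1) span_singleton_point span_singleton_subset_iff
        unfolding points_in_def by blast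
      then have "vec.span {v} \<subseteq> W" using sub unfolding points_in_def by blast
      then show ?thesis using assms(2) span_singleton_subset_iff by blast
    qed
  qed
qed (rule points_in_mono)

lemma points_in_inj:
  "vec.subspace U \<Longrightarrow> vec.subspace W \<Longrightarrow> points_in U = points_in W \<longleftrightarrow> U = W"
  using points_in_subset_iff[of U W] points_in_subset_iff[of W U] by auto

text \<open>An inclusion between one-dimensional subspaces is an equality. This allows
  \<open>{p}\<close> to be treated as a projective subspace, in joins and as an argument of the
  polarity.\<close>

lemma points_in_point:
  assumes "p \<in> pg_points"
  shows "points_in p = {p}"
  using assms vec.subspace_dim_equal[OF subspace_point subspace_point[OF assms]]
  unfolding points_in_def by (auto simp: dim_point)

section \<open>Sums of vector subspaces and projective joins\<close>

lemma vec_sup_subset_iff: "vec.subspace Z \<Longrightarrow> vec_sup U W \<subseteq> Z \<longleftrightarrow> U \<subseteq> Z \<and> W \<subseteq> Z"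
  unfolding vec_sup_def
  using vec.span_superset[of "U \<union> W"] vec.span_minimal[of "U \<union> W" Z] by auto

lemma vec_sup_upper: "U \<subseteq> vec_sup U W" "W \<subseteq> vec_sup U W"
  unfolding vec_sup_def using vec.span_superset[of "U \<union> W"] by auto

lemma vec_sup_assoc: "vec_sup (vec_sup U W) Z = vec_sup U (vec_sup W Z)"
proof (rule antisym)
  have "W \<subseteq> vec_sup U (vec_sup W Z)" "Z \<subseteq> vec_sup U (vec_sup W Z)"
    by (rule order_trans[OF vec_sup_upper(1) vec_sup_upper(2)],
        rule order_trans[OF vec_sup_upper(2) vec_sup_upper(2)])
  then show "vec_sup (vec_sup U W) Z \<subseteq> vec_sup U (vec_sup W Z)"
    by (simp add: vec_sup_subset_iff vec_sup_upper)
  have "U \<subseteq> vec_sup (vec_sup U W) Z" "W \<subseteq> vec_sup (vec_sup U W) Z"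
    by (rule order_trans[OF vec_sup_upper(1) vec_sup_upper(1)],
        rule order_trans[OF vec_sup_upper(2) vec_sup_upper(1)])
  then show "vec_sup U (vec_sup W Z) \<subseteq> vec_sup (vec_sup U W) Z"
    by (simp add: vec_sup_subset_iff vec_sup_upper)
qed

lemma dim_vec_sup_point:
  assumes "p \<in> pg_points" "vec.subspace U" "\<not> p \<subseteq> U"
  shows "vec.dim (vec_sup p U) = vec.dim U + 1"
proof -
  obtain v where v: "v \<noteq> 0" "p = vec.span {v}" using point_eq_span[OF assms(1)] by blast
  have "v \<notin> U" using assms(2,3) v span_singleton_subset_iff by blast
  then have "v \<notin> vec.span U" using assms(2) by (simp add: span_subspace)
  moreover have "vec_sup p U = vec.span (insert v U)"
  proof (rule antisym)
    have "vec.span {v} \<subseteq> vec.span (insert v U)" by (rule vec.span_mono) auto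
    then show "vec_sup p U \<subseteq> vec.span (insert v U)"
      using v vec.span_superset[of "insert v U"] by (subst vec_sup_subset_iff) auto
    show "vec.span (insert v U) \<subseteq> vec_sup p U"
      using v vec.span_base[of v "{v}"] unfolding vec_sup_def by (intro vec.span_mono) auto
  qed
  ultimately show ?thesis by (simp add: vec.dim_insert)
qed

text \<open>The points of the sum form one of the subspaces being intersected and lie in all the
  others.\<close>

lemma pg_join_points_in:
  assumes "vec.subspace U" "vec.subspace W"
  shows "pg_join (points_in U) (points_in W) = points_in (vec_sup U W)"
proof (rule antisym)
  have "points_in (vec_sup U W) \<in> pg_subspaces"
    using pg_subspaces_iff subspace_vec_sup by blast
  then show "pg_join (points_in U) (points_in W) \<subseteq> points_in (vec_sup U W)"
    unfolding pg_join_def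
    by (intro Inter_lower) (simp add: points_in_mono vec_sup_upper)
  show "points_in (vec_sup U W) \<subseteq> pg_join (points_in U) (points_in W)"
    unfolding pg_join_def
  proof (rule Inter_greatest)
    fix S assume S: "S \<in> {W' \<in> pg_subspaces. points_in U \<subseteq> W' \<and> points_in W \<subseteq> W'}"
    then obtain Z where Z: "vec.subspace Z" "S = points_in Z" by (auto simp: pg_subspaces_iff)
    then have "U \<subseteq> Z" "W \<subseteq> Z" using S assms points_in_subset_iff by auto
    then show "points_in (vec_sup U W) \<subseteq> S"
      using Z by (simp add: points_in_mono vec_sup_subset_iff)
  qed
qed

section \<open>Counting points by dimension\<close>

text \<open>A linear isomorphism from \<open>U\<close> onto \<open>W\<close> carries points
  injectively to points, so equal dimensions can be compared without an explicit formula for the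
  number of points.\<close>

lemma card_points_in_le_if_dim_eq:
  fixes U W :: "('a::{field,finite} ^ 'n::finite) set"
  assumes "vec.subspace U" "vec.subspace W" "vec.dim U = vec.dim W"
  shows "card (points_in U) \<le> card (points_in W)"
proof -
  obtain f where f: "Vector_Spaces.linear (*s) (*s) f" "f ` U = W" "inj_on f U"
    using vec.subspace_isomorphism[OF assms] by blast
  interpret f: Vector_Spaces.linear "(*s)" "(*s)" f by (rule f(1))
  have "inj_on ((`) f) (points_in U)"
    using f(3) by (auto simp: inj_on_def points_in_def inj_on_image_eq_iff)
  moreover have "(`) f ` points_in U \<subseteq> points_in W"
  proof (rule image_subsetI)
    fix p assume "p \<in> points_in U"
    then have p: "vec.subspace p" "vec.dim p = 1" "p \<subseteq> U"
      unfolding points_in_def pg_points_def by auto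
    then have "vec.dim (f ` p) = 1"
      using f by (subst vec.dim_image_eq) (auto simp: span_subspace intro: inj_on_subset)
    then show "f ` p \<in> points_in W"
      using p f(2) f.subspace_image unfolding points_in_def pg_points_def by auto
  qed
  ultimately show ?thesis by (intro card_inj_on_le) auto
qed

lemma card_points_in_eq_if_dim_eq:
  fixes U W :: "('a::{field,finite} ^ 'n::finite) set"
  assumes "vec.subspace U" "vec.subspace W" "vec.dim U = vec.dim W"
  shows "card (points_in U) = card (points_in W)"
  using assms by (intro antisym card_points_in_le_if_dim_eq) auto

lemma card_points_in_less_if_psubset:
  fixes U W :: "('a::{field,finite} ^ 'n::finite) set"
  assumes "vec.subspace U" "vec.subspace W" "U \<subset> W"
  shows "card (points_in U) < card (points_in W)"
  using assms points_in_subset_iff[OF assms(1,2)] points_in_subset_iff[OF assms(2,1)]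
  by (intro psubset_card_mono) auto

lemma card_points_in_diff_eq:
  fixes U U' W W' :: "('a::{field,finite} ^ 'n::finite) set"
  assumes "vec.subspace U" "vec.subspace W" "W \<subseteq> U"
    and "vec.subspace U'" "vec.subspace W'" "W' \<subseteq> U'"
    and "vec.dim U = vec.dim U'" "vec.dim W = vec.dim W'"
  shows "card (points_in U - points_in W) = card (points_in U' - points_in W')"
  using assms card_points_in_eq_if_dim_eq[of U U'] card_points_in_eq_if_dim_eq[of W W']
  by (simp add: card_Diff_subset points_in_mono)

text \<open>Removing a subspace of larger dimension from a space of the same dimension leaves fewer
  points.\<close>

lemma card_points_in_diff_less:
  fixes U U' W W' :: "('a::{field,finite} ^ 'n::finite) set"
  assumes "vec.subspace U" "vec.subspace W" "W \<subseteq> U"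
    and "vec.subspace U'" "vec.subspace W'" "W' \<subseteq> U'"
    and "vec.dim U = vec.dim U'" "vec.dim W' < vec.dim W"
  shows "card (points_in U - points_in W) < card (points_in U' - points_in W')"
proof -
  \<comment> \<open>\<open>W\<close> and \<open>W'\<close> need not be nested, so a copy
    \<open>T\<close> of \<open>W'\<close> is chosen inside \<open>W\<close>; both removals then take
    place in \<open>U\<close>.\<close>
  obtain T where T: "vec.subspace T" "T \<subseteq> W" "vec.dim T = vec.dim W'"
    using vec.choose_subspace_of_subspace[of "vec.dim W'" W] assms(2,8)
    by (metis less_imp_le span_subspace)
  have "T \<subset> W" using T assms(8) by auto
  then have "card (points_in T) < card (points_in W)"
    using T assms by (intro card_points_in_less_if_psubset)
  moreover have "card (points_in W) \<le> card (points_in U)"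
    using assms by (intro card_mono points_in_mono) auto
  ultimately have "card (points_in U - points_in W) < card (points_in U - points_in T)"
    using T assms by (simp add: card_Diff_subset points_in_mono)
  also have "\<dots> = card (points_in U' - points_in W')"
    using T assms by (intro card_points_in_diff_eq) auto
  finally show ?thesis .
qed


section \<open>Polarities on vector subspaces\<close>

locale subspace_polarity =
  fixes P :: "('a::field ^ 'n::finite) set \<Rightarrow> ('a ^ 'n) set"
  assumes subspace_P: "vec.subspace U \<Longrightarrow> vec.subspace (P U)"
    and P_antimono: "vec.subspace U \<Longrightarrow> vec.subspace W \<Longrightarrow> U \<subseteq> W \<Longrightarrow> P W \<subseteq> P U"
    and P_P: "vec.subspace U \<Longrightarrow> P (P U) = U"
begin

text \<open>The Galois property of an order-reversing involution; it also gives symmetry of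
  adjacency.\<close>

lemma subset_P_iff: "vec.subspace U \<Longrightarrow> vec.subspace W \<Longrightarrow> U \<subseteq> P W \<longleftrightarrow> W \<subseteq> P U"
  by (metis P_P P_antimono subspace_P)

lemma P_vec_sup:
  assumes "vec.subspace U" "vec.subspace W"
  shows "P (vec_sup U W) = P U \<inter> P W"
proof -
  \<comment> \<open>Both sides contain the same subspaces \<open>Z\<close>; since both are subspaces
    themselves, each contains the other.\<close>
  have "Z \<subseteq> P (vec_sup U W) \<longleftrightarrow> Z \<subseteq> P U \<inter> P W" if "vec.subspace Z" for Z
    using assms that by (auto simp: subset_P_iff[OF that] vec_sup_subset_iff subspace_P)
  moreover have "vec.subspace (P (vec_sup U W))" "vec.subspace (P U \<inter> P W)"
    using assms by (auto intro!: subspace_P vec.subspace_inter)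
  ultimately show ?thesis by (metis subset_antisym order_refl)
qed

lemma dim_P_less:
  assumes "vec.subspace U" "vec.subspace W" "U \<subset> W"
  shows "vec.dim (P W) < vec.dim (P U)"
proof -
  have "P W \<subset> P U" using assms P_antimono P_P by (metis psubset_eq)
  then show ?thesis using assms by (intro vec.dim_psubset) (simp only: subspace_P span_subspace)
qed

text \<open>Climbing from \<open>U\<close> to the whole space one dimension at a time lowers the
  dimension of the image by at least one per step, so \<open>P U\<close> must have at least as many
  dimensions as there are steps.\<close>

lemma dim_P_ge:
  assumes "vec.subspace U"
  shows "CARD('n) \<le> vec.dim U + vec.dim (P U)"
  using assms
proof (induction "CARD('n) - vec.dim U" arbitrary: U)
  case 0
  then show ?case by simp
next
  case (Suc d)
  then have "U \<noteq> UNIV" using vec_dim_card by (metis diff_self_eq_0 nat.distinct(1))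
  then obtain v where v: "v \<notin> U" by blast
  let ?W = "vec.span (insert v U)"
  have dimW: "vec.dim ?W = vec.dim U + 1"
    using v Suc.prems by (simp add: vec.dim_insert span_subspace)
  have "U \<subset> ?W" using v vec.span_superset[of "insert v U"] by auto
  then have "vec.dim (P ?W) < vec.dim (P U)" using Suc.prems by (intro dim_P_less) auto
  moreover have "CARD('n) \<le> vec.dim ?W + vec.dim (P ?W)"
    using Suc.hyps dimW by (intro Suc.hyps(1)) auto
  ultimately show ?case using dimW by linarith
qed

text \<open>The descending counterpart: going down from \<open>U\<close> to the zero subspace raises
  the dimension of the image at each step, and that dimension cannot exceed
  \<open>CARD('n)\<close>.\<close>

lemma dim_P_le:
  assumes "vec.subspace U"
  shows "vec.dim U + vec.dim (P U) \<le> CARD('n)"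
  using assms
proof (induction "vec.dim U" arbitrary: U)
  case 0
  then show ?case using dim_subset_UNIV_cart_gen[of "P U"] by linarith
next
  case (Suc d)
  obtain W where W: "vec.subspace W" "W \<subseteq> U" "vec.dim W = d"
    using vec.choose_subspace_of_subspace[of d U] Suc.hyps(2) Suc.prems
    by (metis le_SucI order_refl span_subspace)
  then have "W \<subset> U" using Suc.hyps(2) by auto
  then have "vec.dim (P U) < vec.dim (P W)" using W Suc.prems by (intro dim_P_less)
  then show ?case using Suc.hyps W by force
qed

lemma dim_P: "vec.subspace U \<Longrightarrow> vec.dim (P U) = CARD('n) - vec.dim U"
  using dim_P_ge[of U] dim_P_le[of U] by linarith

end

lemma polarity_subspace_polarity:
  fixes \<zeta> :: "('a::field ^ 'n::finite) set set \<Rightarrow> ('a ^ 'n) set set"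
  assumes "polarity \<zeta>"
  obtains P where "subspace_polarity P" "\<And>U. vec.subspace U \<Longrightarrow> \<zeta> (points_in U) = points_in (P U)"
proof -
  have sub: "\<zeta> S \<in> pg_subspaces" if "S \<in> pg_subspaces" for S
    using assms that unfolding polarity_def by (auto dest: bij_betw_apply)
  \<comment> \<open>The guard sits inside the existential so that choice yields a total
    \<open>P\<close>, constrained on subspaces only.\<close>
  have "\<forall>U. \<exists>W. vec.subspace U \<longrightarrow> vec.subspace W \<and> \<zeta> (points_in U) = points_in W"
    using sub by (auto simp: pg_subspaces_iff)
  then obtain P where
    P: "\<And>U. vec.subspace U \<Longrightarrow> vec.subspace (P U) \<and> \<zeta> (points_in U) = points_in (P U)"
    by metis
  have "subspace_polarity P"
  proof
    fix U W :: "('a ^ 'n) set"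
    assume U: "vec.subspace U"
    then have Us: "points_in U \<in> pg_subspaces" using pg_subspaces_iff by blast
    show "vec.subspace (P U)" using P U by blast
    have "points_in (P (P U)) = points_in U"
      using P U Us assms unfolding polarity_def by metis
    then show "P (P U) = U" using P U points_in_inj by blast
    assume W: "vec.subspace W" "U \<subseteq> W"
    then have "points_in W \<in> pg_subspaces" using pg_subspaces_iff by blast
    then have "\<zeta> (points_in W) \<subseteq> \<zeta> (points_in U)"
      using Us points_in_mono[OF W(2)] assms unfolding polarity_def by blast
    then show "P W \<subseteq> P U" using P U W points_in_subset_iff by metis
  qed
  then show thesis using that P by blast
qed


section \<open>The graph of a polarity\<close>

locale isotropic_subspace = subspace_polarity P
  for P :: "('a::{field,finite} ^ 'n::finite) set \<Rightarrow> ('a ^ 'n) set" +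
  fixes A :: "('a ^ 'n) set"
  assumes subspace_A: "vec.subspace A"
    and A_nontrivial: "vec.dim A \<ge> 1"
    and A_isotropic: "A \<subseteq> P A"
    and dim_ge_3: "CARD('n) \<ge> 3"
begin

definition V :: "('a ^ 'n) set set" where
  "V = pg_points - points_in (P A)"

lemma point_V: "x \<in> V \<Longrightarrow> x \<in> pg_points"
  and not_subset_PA: "x \<in> V \<Longrightarrow> \<not> x \<subseteq> P A"
  and not_subset_A: "x \<in> V \<Longrightarrow> \<not> x \<subseteq> A"
  using A_isotropic unfolding V_def points_in_def by auto

lemma subspace_V: "x \<in> V \<Longrightarrow> vec.subspace x"
  using point_V subspace_point by blast

lemma subspace_PA: "vec.subspace (P A)"
  using subspace_A by (rule subspace_P)

text \<open>Isotropy bounds \<open>2 * vec.dim A\<close> by \<open>CARD('n)\<close>; this leaves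
  room for a point outside \<open>vec_sup x A\<close>.\<close>

lemma dim_A_add_2_le: "vec.dim A + 2 \<le> CARD('n)"
proof -
  have "vec.dim A \<le> CARD('n) - vec.dim A"
    using vec.dim_subset[OF A_isotropic] dim_P[OF subspace_A] by simp
  then show ?thesis using dim_ge_3 A_nontrivial by linarith
qed

lemma dim_vec_sup_V:
  assumes "x \<in> V"
  shows "vec.dim (vec_sup x A) = vec.dim A + 1"
  using dim_vec_sup_point[OF point_V subspace_A not_subset_A, OF assms assms] .

lemma vec_sup_subset_imp_eq:
  assumes "p \<in> pg_points" "\<not> p \<subseteq> A" "x \<in> V" "p \<subseteq> vec_sup x A"
  shows "vec_sup p A = vec_sup x A"
proof (rule vec.subspace_dim_equal)
  show "vec_sup p A \<subseteq> vec_sup x A"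
    using assms(4) vec_sup_upper(2)[of A x] by (simp add: vec_sup_subset_iff)
  show "vec.dim (vec_sup x A) \<le> vec.dim (vec_sup p A)"
    using dim_vec_sup_V[OF assms(3)] dim_vec_sup_point[OF assms(1) subspace_A assms(2)] by simp
qed simp_all

section \<open>The classes of the equivalence relation\<close>

definition cell :: "('a ^ 'n) set \<Rightarrow> ('a ^ 'n) set set" where
  "cell x = {y \<in> V. vec_sup y A = vec_sup x A}"

text \<open>A point \<open>p\<close> of \<open>x + A\<close> outside \<open>A\<close> is
  automatically a vertex: if it were in \<open>P A\<close>, isotropy would put
  \<open>p + A = x + A\<close>, and hence \<open>x\<close>, in \<open>P A\<close>. Class sizes
  therefore depend on dimensions only.\<close>

lemma cell_eq:
  assumes x: "x \<in> V"
  shows "cell x = points_in (vec_sup x A) - points_in A"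
proof (rule antisym)
  show "cell x \<subseteq> points_in (vec_sup x A) - points_in A"
    using not_subset_A vec_sup_upper(1)[of _ A] by (auto simp: cell_def points_in_def V_def)
  show "points_in (vec_sup x A) - points_in A \<subseteq> cell x"
  proof
    fix p assume "p \<in> points_in (vec_sup x A) - points_in A"
    then have p: "p \<in> pg_points" "p \<subseteq> vec_sup x A" "\<not> p \<subseteq> A" unfolding points_in_def by auto
    have eq: "vec_sup p A = vec_sup x A" using vec_sup_subset_imp_eq[OF p(1,3) x p(2)] .
    have "\<not> p \<subseteq> P A"
    proof
      assume "p \<subseteq> P A"
      then have "vec_sup p A \<subseteq> P A"
        using subspace_PA A_isotropic by (simp add: vec_sup_subset_iff)
      then show False using eq not_subset_PA[OF x] vec_sup_upper(1)[of x A] by blast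
    qed
    then show "p \<in> cell x" using p eq unfolding cell_def V_def points_in_def by blast
  qed
qed

lemma card_cell_eq:
  assumes "x \<in> V" "y \<in> V"
  shows "card (cell x) = card (cell y)"
  unfolding cell_eq[OF assms(1)] cell_eq[OF assms(2)]
  using assms subspace_A vec_sup_upper(2)
  by (intro card_points_in_diff_eq) (auto simp: dim_vec_sup_V)

text \<open>Shifting a spanning vector \<open>v\<close> of \<open>x\<close> by a nonzero
  \<open>a\<close> in \<open>A\<close> gives a second point of the class. If it were
  \<open>x\<close> again, then \<open>a\<close> would span \<open>x\<close>, forcing
  \<open>x\<close> into \<open>A\<close>.\<close>

lemma card_cell_ge_2:
  assumes x: "x \<in> V"
  shows "card (cell x) \<ge> 2"
proof -
  obtain v where v: "v \<noteq> 0" "x = vec.span {v}" using point_eq_span[OF point_V[OF x]] by blast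
  have "\<not> A \<subseteq> {0}" using A_nontrivial by (metis vec.dim_eq_0 not_one_le_zero)
  then obtain a where a: "a \<in> A" "a \<noteq> 0" by blast
  have vA: "v \<notin> A" using not_subset_A[OF x] v span_singleton_subset_iff[OF subspace_A] by blast
  then have vaA: "v + a \<notin> A" using a(1) subspace_A vec.subspace_diff[of A "v + a" a] by auto
  let ?y = "vec.span {v + a}"
  have y: "?y \<in> pg_points" using vaA vec.subspace_0[OF subspace_A] span_singleton_point by metis
  have vx: "v \<in> x" using v vec.span_base[of v "{v}"] by blast
  have "v + a \<in> vec_sup x A"
    unfolding vec_sup_def using vx a by (intro vec.span_add vec.span_base) auto
  then have "?y \<in> cell x"
    using y vaA subspace_A unfolding cell_eq[OF x] points_in_def
    by (auto simp: span_singleton_subset_iff)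
  moreover have "x \<in> cell x" using x unfolding cell_def by blast
  moreover have "?y \<noteq> x"
  proof
    assume "?y = x"
    then have "v + a \<in> x" using vec.span_base[of "v + a" "{v + a}"] by blast
    then have "a \<in> x" using vec.subspace_diff[OF subspace_V[OF x] _ vx, of "v + a"] by simp
    then have "vec.span {a} \<subseteq> x" using span_singleton_subset_iff[OF subspace_V[OF x]] by blast
    then have "vec.span {a} = x"
      using points_in_point[OF point_V[OF x]] span_singleton_point[OF a(2)]
      unfolding points_in_def by blast
    then show False
      using span_singleton_subset_iff[OF subspace_A] a(1) not_subset_A[OF x] by blast
  qed
  ultimately have "{x, ?y} \<subseteq> cell x" "card {x, ?y} = 2" by simp_all
  then show ?thesis by (metis card_mono finite)
qed

text \<open>A vector space is not the union of the two proper subspaces \<open>P A\<close> and \<open>x + A\<close>.\<close>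

lemma V_nonempty: "V \<noteq> {}"
  and V_not_single_cell: "x \<in> V \<Longrightarrow> \<exists>y\<in>V. vec_sup y A \<noteq> vec_sup x A"
proof -
  have "vec.dim (P A) \<noteq> CARD('n)" using dim_P[OF subspace_A] A_nontrivial dim_ge_3 by simp
  then obtain z where z: "z \<notin> P A" by (metis UNIV_eq_I vec_dim_card)
  have V_span: "vec.span {w} \<in> V" if "w \<notin> P A" for w
    using that subspace_PA vec.subspace_0[OF subspace_PA] span_singleton_point[of w]
    by (auto simp: V_def points_in_def span_singleton_subset_iff)
  then show "V \<noteq> {}" using z by blast
  assume x: "x \<in> V"
  \<comment> \<open>Properness of \<open>x + A\<close> holds because its dimension is
    \<open>vec.dim A + 1\<close>, still below \<open>CARD('n)\<close>.\<close>
  have "vec.dim (vec_sup x A) \<noteq> CARD('n)" using dim_vec_sup_V[OF x] dim_A_add_2_le by simp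
  then obtain w where w: "w \<notin> vec_sup x A" by (metis UNIV_eq_I vec_dim_card)
  have far: "vec_sup (vec.span {u}) A \<noteq> vec_sup x A" if "u \<notin> vec_sup x A" for u
    using that vec_sup_upper(1)[of "vec.span {u}" A] vec.span_base[of u "{u}"] by blast
  obtain u where u: "u \<notin> P A" "u \<notin> vec_sup x A"
  proof (cases "w \<in> P A")
    case False
    then show thesis using that w by blast
  next
    case wP: True
    show thesis
    proof (cases "z \<in> vec_sup x A")
      case False
      then show thesis using that z by blast
    next
      case True
      have "z + w \<notin> P A"
        using z wP vec.subspace_diff[OF subspace_PA, of "z + w" w] by auto
      moreover have "z + w \<notin> vec_sup x A"
        using w True vec.subspace_diff[of "vec_sup x A" "z + w" z] by auto
      ultimately show thesis using that by blast
    qed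
  qed
  then show "\<exists>y\<in>V. vec_sup y A \<noteq> vec_sup x A" using V_span far by blast
qed

section \<open>Neighbourhoods and common neighbours\<close>

definition common :: "('a ^ 'n) set \<Rightarrow> ('a ^ 'n) set set" where
  "common W = points_in (P W) - points_in (P A)"

text \<open>Points of \<open>P W\<close> lying in \<open>P A\<close> are those of
  \<open>P W \<inter> P A = P (W + A)\<close>. The difference becomes one of nested subspaces, to
  which the dimension-only counts apply.\<close>

lemma common_eq:
  assumes "vec.subspace W"
  shows "common W = points_in (P W) - points_in (P (vec_sup W A))"
  unfolding common_def P_vec_sup[OF assms subspace_A] points_in_Int by blast

lemma card_common_eq:
  assumes "vec.subspace W" "vec.subspace W'" "vec.dim W = vec.dim W'"
    and "vec.dim (vec_sup W A) = vec.dim (vec_sup W' A)"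
  shows "card (common W) = card (common W')"
  unfolding common_eq[OF assms(1)] common_eq[OF assms(2)]
  using assms by (intro card_points_in_diff_eq P_antimono vec_sup_upper) (simp_all add: subspace_P dim_P)

lemma card_common_less:
  assumes "vec.subspace W" "vec.subspace W'" "vec.dim W = vec.dim W'"
    and "vec.dim (vec_sup W A) < vec.dim (vec_sup W' A)"
  shows "card (common W) < card (common W')"
  unfolding common_eq[OF assms(1)] common_eq[OF assms(2)]
proof (rule card_points_in_diff_less)
  show "vec.dim (P (vec_sup W' A)) < vec.dim (P (vec_sup W A))"
    \<comment> \<open>Subtraction in \<open>dim_P\<close> is truncated, so strictness requires the
      larger dimension not to exceed \<open>CARD('n)\<close>.\<close>
    using assms(4) dim_subset_UNIV_cart_gen[of "vec_sup W' A"] by (simp add: dim_P)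
qed (use assms in \<open>simp_all add: subspace_P dim_P P_antimono vec_sup_upper\<close>)

lemma dim_vec_sup_pair:
  assumes "x \<in> V" "y \<in> V" "x \<noteq> y"
  shows "vec.dim (vec_sup x y) = 2"
proof -
  have "\<not> x \<subseteq> y"
    using assms points_in_point[OF point_V[OF assms(2)]] point_V unfolding points_in_def by blast
  then show ?thesis
    using dim_vec_sup_point[OF point_V[OF assms(1)] subspace_V[OF assms(2)]]
      dim_point[OF point_V[OF assms(2)]] by simp
qed

text \<open>Adding the point \<open>x\<close> to \<open>y + A\<close> raises the dimension by one
  unless \<open>x\<close> already lies there, which happens exactly when the classes agree.\<close>

lemma dim_vec_sup_pair_A:
  assumes "x \<in> V" "y \<in> V"
  shows "vec.dim (vec_sup (vec_sup x y) A) =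
    (if vec_sup x A = vec_sup y A then vec.dim A + 1 else vec.dim A + 2)"
proof -
  note eq = vec_sup_assoc[of x y A]
  show ?thesis
  proof (cases "x \<subseteq> vec_sup y A")
    case True
    then have "vec_sup x A = vec_sup y A"
      using assms point_V not_subset_A by (intro vec_sup_subset_imp_eq) auto
    moreover have "vec_sup x (vec_sup y A) = vec_sup y A"
      using True vec_sup_upper(2)[of "vec_sup y A" x] by (intro antisym) (auto simp: vec_sup_subset_iff)
    ultimately show ?thesis using dim_vec_sup_V[OF assms(2)] unfolding eq by simp
  next
    case False
    then have "vec_sup x A \<noteq> vec_sup y A" using vec_sup_upper(1)[of x A] by blast
    then show ?thesis
      using dim_vec_sup_point[OF point_V[OF assms(1)] _ False] dim_vec_sup_V[OF assms(2)]
      unfolding eq by simp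
  qed
qed

text \<open>Adjacency is stated through \<open>P\<close> alone, so that the whole graph argument
  stays with vector subspaces.\<close>

lemma proper_LDDG_cells:
  assumes verts: "pverts G = V"
    and arcs: "\<And>x y. x \<in> V \<Longrightarrow> y \<in> V \<Longrightarrow> (x, y) \<in> parcs G \<longleftrightarrow> x \<subseteq> P y"
    and arcs_V: "parcs G \<subseteq> V \<times> V"
  shows "\<exists>v d l1 l2 m n. proper_LDDG G v d l1 l2 m n \<and> LDDG_partition G l1 l2 m n (cell ` V)"
proof -
  have nb: "neighbours G x = common x" if x: "x \<in> V" for x
  proof -
    have "neighbours G x = {y \<in> V. y \<subseteq> P x}"
      using subset_P_iff[OF subspace_V[OF x] subspace_V] arcs[OF x] verts
      by (auto simp: neighbours_def)
    then show ?thesis by (auto simp: common_def V_def points_in_def)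
  qed
  have cn: "neighbours G x \<inter> neighbours G y = common (vec_sup x y)" if "x \<in> V" "y \<in> V" for x y
    using that by (auto simp: nb common_def P_vec_sup subspace_V points_in_Int)
  obtain x where x: "x \<in> V" using V_nonempty by blast
  have "\<not> cell x \<subseteq> {x}" using card_cell_ge_2[OF x] card_mono[of "{x}" "cell x"] by auto
  then obtain x' where x': "x' \<in> cell x" "x' \<noteq> x" by blast
  have x'V: "x' \<in> V" "vec_sup x' A = vec_sup x A" using x' unfolding cell_def by auto
  obtain y where y: "y \<in> V" "vec_sup y A \<noteq> vec_sup x A" using V_not_single_cell[OF x] by blast
  \<comment> \<open>Both constants are read off from sample pairs, one within a class and one across
    classes; \<open>card_common_eq\<close> carries them to all other pairs.\<close>
  let ?l1 = "card (common (vec_sup x x'))" and ?l2 = "card (common (vec_sup x y))"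
  have dim1: "vec.dim (vec_sup x x') = 2" "vec.dim (vec_sup (vec_sup x x') A) = vec.dim A + 1"
    using dim_vec_sup_pair[OF x x'V(1)] dim_vec_sup_pair_A[OF x x'V(1)] x'(2) x'V(2) by auto
  have dim2: "vec.dim (vec_sup x y) = 2" "vec.dim (vec_sup (vec_sup x y) A) = vec.dim A + 2"
    using dim_vec_sup_pair[OF x y(1)] dim_vec_sup_pair_A[OF x y(1)] y(2) by auto
  have less: "?l1 < ?l2" by (rule card_common_less) (simp_all add: dim1 dim2)
  have part: "partition_on V (cell ` V)"
    by (rule partition_onI) (auto simp: cell_def disjnt_def)
  have LP: "LDDG_partition G ?l1 ?l2 (card (cell ` V)) (card (cell x)) (cell ` V)"
    unfolding LDDG_partition_def verts
  proof (intro conjI ballI impI)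
    fix C assume "C \<in> cell ` V"
    then obtain c where c: "c \<in> V" "C = cell c" by blast
    then show "card C = card (cell x)" using card_cell_eq[OF c(1) x] by simp
    {
      fix u w assume uw: "u \<in> C" "w \<in> C" "u \<noteq> w"
      then have "u \<in> V" "w \<in> V" "vec_sup u A = vec_sup w A" using c unfolding cell_def by auto
      then show "card (neighbours G u \<inter> neighbours G w) = ?l1"
        using uw(3) by (simp add: cn)
          (rule card_common_eq, simp_all add: dim_vec_sup_pair dim_vec_sup_pair_A dim1)
    }
    fix D u w assume "D \<in> cell ` V" and uw: "C \<noteq> D" "u \<in> C" "w \<in> D"
    then obtain d where d: "d \<in> V" "D = cell d" by blast
    have "u \<in> V" "w \<in> V" "vec_sup u A \<noteq> vec_sup w A" using c d uw unfolding cell_def by auto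
    moreover from this have "u \<noteq> w" by blast
    ultimately show "card (neighbours G u \<inter> neighbours G w) = ?l2"
      by (simp add: cn)
          (rule card_common_eq, simp_all add: dim_vec_sup_pair dim_vec_sup_pair_A dim2)
  qed (use part in auto)
  have "pair_pseudo_graph G"
  proof
    show "symmetric G"
      unfolding symmetric_def arcs_ends_conv
      using arcs arcs_V subset_P_iff[OF subspace_V subspace_V] by (auto intro!: symI)
  qed (use arcs_V verts in auto)
  \<comment> \<open>A neighbourhood is \<open>common\<close> of a single point, so the same count
    applies with dimensions 1 and \<open>vec.dim A + 1\<close>.\<close>
  moreover have "regular_graph G (card (common x))"
    unfolding regular_graph_def verts
    using x by (auto simp: nb subspace_V dim_point point_V dim_vec_sup_V intro!: card_common_eq)
  moreover have "card (cell ` V) \<ge> 2"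
  proof -
    have "x \<in> cell x" "x \<notin> cell y" using x y unfolding cell_def by auto
    then have "card {cell x, cell y} = 2" by (metis card_2_iff)
    moreover have "card {cell x, cell y} \<le> card (cell ` V)" using x y by (intro card_mono) auto
    ultimately show ?thesis by simp
  qed
  ultimately have "proper_LDDG G (card V) (card (common x)) ?l1 ?l2 (card (cell ` V)) (card (cell x))"
    using LP less verts card_cell_ge_2[OF x] unfolding proper_LDDG_def LDDG_def by auto
  then show ?thesis using LP by blast
qed

end

section \<open>Translation back to projective subspaces\<close>

theorem theorem1p2:
  fixes \<zeta> :: "('a::{field,finite} ^ 'n::finite) set set \<Rightarrow> ('a ^ 'n) set set"
    and \<pi> :: "('a ^ 'n) set set"
    and k :: nat
  assumes "CARD('n) \<ge> 3"
    and "polarity \<zeta>"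
    and "pg_subspace_of_dim (int k - 1) \<pi>" and "int k - 1 \<ge> 0"
    and "\<pi> \<subseteq> \<zeta> \<pi>"
  shows "let V = pg_points - \<zeta> \<pi>;
             R = {(x, y). x \<in> V \<and> y \<in> V \<and> pg_join {x} \<pi> = pg_join {y} \<pi>};
             \<Gamma> = polarity_graph \<zeta> \<pi>
         in (\<exists>v d l1 l2 m n. proper_LDDG \<Gamma> v d l1 l2 m n) \<and> canonical_partition \<Gamma> = V // R"
proof -
  obtain P where P: "subspace_polarity P"
    and \<zeta>P: "\<And>U. vec.subspace U \<Longrightarrow> \<zeta> (points_in U) = points_in (P U)"
    using polarity_subspace_polarity[OF assms(2)] by blast
  interpret subspace_polarity P by (rule P)
  obtain A where A: "vec.subspace A" "vec.dim A = k" "\<pi> = points_in A"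
    using assms(3) unfolding pg_subspace_of_dim_def points_in_def by auto
  interpret isotropic_subspace P A
    using assms A by unfold_locales (auto simp: \<zeta>P points_in_subset_iff subspace_P)
  have V: "pg_points - \<zeta> \<pi> = V" unfolding V_def A(3) \<zeta>P[OF A(1)] ..
  \<comment> \<open>Here \<open>{y}\<close> is read as \<open>points_in y\<close>, so that its image
    under \<zeta> is \<open>points_in (P y)\<close>.\<close>
  have adj: "x \<in> \<zeta> {y} \<longleftrightarrow> x \<subseteq> P y" if "x \<in> V" "y \<in> V" for x y
    using \<zeta>P[OF subspace_V[OF that(2)]] points_in_point[OF point_V[OF that(2)]] point_V[OF that(1)]
    by (auto simp: points_in_def)
  have join: "pg_join {x} \<pi> = pg_join {y} \<pi> \<longleftrightarrow> vec_sup x A = vec_sup y A"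
    if "x \<in> V" "y \<in> V" for x y
    using pg_join_points_in[OF subspace_V[OF that(1)] A(1)]
      pg_join_points_in[OF subspace_V[OF that(2)] A(1)]
    by (simp add: points_in_point point_V that A(3) points_in_inj)
  have quot: "V // {(x, y). x \<in> V \<and> y \<in> V \<and> pg_join {x} \<pi> = pg_join {y} \<pi>} = cell ` V"
    (is "V // ?R = _")
  proof -
    have "?R `` {x} = cell x" if "x \<in> V" for x
      using that join unfolding cell_def by auto
    then show ?thesis unfolding quotient_def by blast
  qed
  have "\<exists>v d l1 l2 m n. proper_LDDG (polarity_graph \<zeta> \<pi>) v d l1 l2 m n \<and>
      LDDG_partition (polarity_graph \<zeta> \<pi>) l1 l2 m n (cell ` V)"
    by (rule proper_LDDG_cells) (auto simp: polarity_graph_def V adj)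
  then show ?thesis
    unfolding Let_def V quot using canonical_partition_eqI by blast
qed

end
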